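(* Let $\mathcal{A}$ be a locally small almost disjoint family of countable sets, of cardinality $\omega_1$. Then $\mathcal{A}$ is equivalent to a family of the form $$\bigcup_{n\in\mathbb{N}}(\mathcal{A}_n+_{\phi_n}\mathcal{B}_n),$$ where all the $\mathcal{A}_n$ are ladder systems, all the $\mathcal{B}_n$ are disjointifiable, and each $\phi_n$ is an injection defined on a subfamily of $\mathcal{A}_n$ (with values in $\mathcal{B}_n$).
   Context: A family $\mathcal{A}$ of infinite sets is almost disjoint if $A\cap B$ is finite for all distinct $A,B\in\mathcal{A}$; "countable sets" means that all its members are countably infinite. $\mathcal{A}$ is locally small if for every countable $B\subseteq\bigcup\mathcal{A}$ the set $\{A\in\mathcal{A}: A\cap B\text{ is infinite}\}$ is at most countable. Two almost disjoint families $\mathcal{A}$ and $\mathcal{B}$ of countable sets are equivalent if the Boolean algebra of subsets of $\bigcup\mathcal{A}$ generated by $\mathcal{A}$ and the finite subsets of $\bigcup\mathcal{A}$ is isomorphic to the Boolean algebra of subsets of $\bigcup\mathcal{B}$ generated by $\mathcal{B}$ and the finite subsets of $\bigcup\mathcal{B}$. A family is disjointifiable if it is equivalent to a pairwise disjoint family. If $\mathcal{A}\cup\mathcal{B}$ is an almost disjoint family, $\mathcal{A}'\subseteq\mathcal{A}$ and $\phi:\mathcal{A}'\to\mathcal{B}$ is an injection, then $\mathcal{A}+_\phi\mathcal{B}$ denotes the family $$(\mathcal{A}\setminus\mathcal{A}')\cup\{A'\cup\phi(A'): A'\in\mathcal{A}'\}\cup(\mathcal{B}\setminus\phi[\mathcal{A}']).$$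 For an uncountable cardinal $\kappa$ let $E_\kappa(\omega)=\{\alpha\in\kappa:\operatorname{cf}(\alpha)=\omega\}$. A ladder system on $S\subseteq E_\kappa(\omega)$ is an indexed family $(L_\alpha)_{\alpha\in S}$ such that each $L_\alpha$ is a set of ordinals from $\kappa\setminus E_\kappa(\omega)$ of order type $\omega$ with $L_\alpha\subseteq\alpha$ and $\sup L_\alpha=\alpha$. It is identified with the (almost disjoint) family of its members. *)

theory Defs
  imports "HOL-Analysis.Sigma_Algebra"
begin

unbundle cardinal_syntax

definition almost_disjoint :: "'a set set \<Rightarrow> bool" where
  "almost_disjoint \<A> \<longleftrightarrow>
     (\<forall>X\<in>\<A>. infinite X) \<and> pairwise (\<lambda>X Y. finite (X \<inter> Y)) \<A>"

definition countable_ad_family :: "'a set set \<Rightarrow> bool" where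
  "countable_ad_family \<A> \<longleftrightarrow> almost_disjoint \<A> \<and> (\<forall>X\<in>\<A>. countable X)"

definition locally_small :: "'a set set \<Rightarrow> bool" where
  "locally_small \<A> \<longleftrightarrow>
     (\<forall>B. B \<subseteq> \<Union>\<A> \<and> countable B \<longrightarrow> countable {X\<in>\<A>. infinite (X \<inter> B)})"

definition generated_algebra :: "'a set set \<Rightarrow> 'a set set" where
  "generated_algebra \<A> =
     algebra (\<Union>\<A>) hull (\<A> \<union> {F. finite F \<and> F \<subseteq> \<Union>\<A>})"

definition set_algebra_iso ::
    "('a set \<Rightarrow> 'b set) \<Rightarrow> 'a set \<Rightarrow> 'a set set \<Rightarrow> 'b set \<Rightarrow> 'b set set \<Rightarrow> bool" where
  "set_algebra_iso h \<Omega> M \<Omega>' N \<longleftrightarrow>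
     bij_betw h M N \<and> h {} = {} \<and> h \<Omega> = \<Omega>' \<and>
     (\<forall>X\<in>M. h (\<Omega> - X) = \<Omega>' - h X) \<and>
     (\<forall>X\<in>M. \<forall>Y\<in>M. h (X \<union> Y) = h X \<union> h Y \<and> h (X \<inter> Y) = h X \<inter> h Y)"

definition equivalent_families :: "'a set set \<Rightarrow> 'b set set \<Rightarrow> bool" where
  "equivalent_families \<A> \<B> \<longleftrightarrow>
     countable_ad_family \<A> \<and> countable_ad_family \<B> \<and>
     (\<exists>h. set_algebra_iso h (\<Union>\<A>) (generated_algebra \<A>) (\<Union>\<B>) (generated_algebra \<B>))"

text \<open>
  Taking the disjoint family over the same type as \<open>\<A>\<close> is no restriction: an isomorphism of
  the generated algebras maps atoms to atoms, i.e. singletons to singletons, so the unions of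
  equivalent families are equipotent and any disjoint family equivalent to \<open>\<A>\<close> has a copy
  on \<open>\<Union>\<A>\<close>.
\<close>

definition disjointifiable :: "'a set set \<Rightarrow> bool" where
  "disjointifiable \<A> \<longleftrightarrow> (\<exists>\<D> :: 'a set set. disjoint \<D> \<and> equivalent_families \<A> \<D>)"

text \<open>
  The family \<open>\<A> +\<^sub>\<phi> \<B>\<close>, where the domain \<open>\<A>'\<close> of the partial map \<open>\<phi>\<close> is an explicit argument.
\<close>

definition ad_sum :: "'a set set \<Rightarrow> 'a set set \<Rightarrow> ('a set \<Rightarrow> 'a set) \<Rightarrow> 'a set set \<Rightarrow> 'a set set" where
  "ad_sum \<A> \<A>' \<phi> \<B> = (\<A> - \<A>') \<union> {X \<union> \<phi> X |X. X \<in> \<A>'} \<union> (\<B> - \<phi> ` \<A>')"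

definition ad_sum_admissible ::
    "'a set set \<Rightarrow> 'a set set \<Rightarrow> ('a set \<Rightarrow> 'a set) \<Rightarrow> 'a set set \<Rightarrow> bool" where
  "ad_sum_admissible \<A> \<A>' \<phi> \<B> \<longleftrightarrow>
     almost_disjoint (\<A> \<union> \<B>) \<and> \<A>' \<subseteq> \<A> \<and> inj_on \<phi> \<A>' \<and> \<phi> ` \<A>' \<subseteq> \<B>"

text \<open>
  A cardinal \<open>\<kappa>\<close> is a cardinal order in the sense of the library, the ordinals below \<open>\<kappa>\<close>
  being the elements of \<^term>\<open>Field \<kappa>\<close>; an ordinal \<open>\<alpha> \<in> Field \<kappa>\<close> is as a set of
  ordinals \<^term>\<open>underS \<kappa> \<alpha>\<close>.
\<close>

definition cofinal_below :: "'o rel \<Rightarrow> 'o \<Rightarrow> 'o set \<Rightarrow> bool" where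
  "cofinal_below \<kappa> \<alpha> C \<longleftrightarrow>
     C \<subseteq> underS \<kappa> \<alpha> \<and> (\<forall>\<beta>\<in>underS \<kappa> \<alpha>. \<exists>\<gamma>\<in>C. (\<beta>, \<gamma>) \<in> \<kappa>)"

text \<open>\<open>cf(\<alpha>) = \<mu>\<close>: the least cardinality of a cofinal subset of \<open>\<alpha>\<close> is \<open>\<mu>\<close>.\<close>

definition has_cofinality :: "'o rel \<Rightarrow> 'o \<Rightarrow> 'c rel \<Rightarrow> bool" where
  "has_cofinality \<kappa> \<alpha> \<mu> \<longleftrightarrow>
     (\<exists>C. cofinal_below \<kappa> \<alpha> C \<and> |C| =o \<mu>) \<and>
     (\<forall>C. cofinal_below \<kappa> \<alpha> C \<longrightarrow> \<mu> \<le>o |C| )"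

definition E_omega :: "'o rel \<Rightarrow> 'o set" where
  "E_omega \<kappa> = {\<alpha> \<in> Field \<kappa>. has_cofinality \<kappa> \<alpha> natLeq}"

text \<open>
  As \<open>=o\<close> is isomorphism of well-orders and not mere equipotence, the last-but-one
  condition below says that \<open>L \<alpha>\<close> has order type \<open>\<omega>\<close>.
\<close>

definition ladder_system :: "'o rel \<Rightarrow> 'o set \<Rightarrow> ('o \<Rightarrow> 'o set) \<Rightarrow> bool" where
  "ladder_system \<kappa> S L \<longleftrightarrow>
     S \<subseteq> E_omega \<kappa> \<and>
     (\<forall>\<alpha>\<in>S. L \<alpha> \<subseteq> Field \<kappa> - E_omega \<kappa> \<and> L \<alpha> \<subseteq> underS \<kappa> \<alpha> \<and>
            Restr \<kappa> (L \<alpha>) =o natLeq \<and> wo_rel.supr \<kappa> (L \<alpha>) = \<alpha>)"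

definition ladder_family :: "'o rel \<Rightarrow> 'o set set \<Rightarrow> bool" where
  "ladder_family \<kappa> \<A> \<longleftrightarrow> (\<exists>S L. ladder_system \<kappa> S L \<and> \<A> = L ` S)"

text \<open>
  The type of \<open>cardSuc natLeq\<close> is \<^typ>\<open>nat set rel\<close>: the countable ordinals are represented
  by certain sets of naturals, whose own elements play no role.
\<close>

abbreviation omega1 :: "nat set rel" where
  "omega1 \<equiv> cardSuc natLeq"

end

theory Submission
  imports Defs "HOL-Library.Countable_Set_Type"
begin

text \<open>
  The ground set of \<open>\<A>\<close> has at most \<open>\<omega>\<^sub>1\<close> points, so an injection \<open>f\<close> turns the points into
  successor ordinals below \<open>\<omega>\<^sub>1\<close>. Every infinite set of ordinals has an initial segment of order
  type \<open>\<omega>\<close>. For \<open>A \<in> \<A>\<close> let \<open>start A\<close> be this initial segment of \<open>f ` A\<close>, let \<open>height A\<close> be its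
  supremum and let \<open>rest A\<close> be the remaining part of \<open>f ` A\<close>, which lies above. Then \<open>start A\<close> is a
  ladder at \<open>height A\<close>, and the task is to distribute \<open>\<A>\<close> over countably many classes so that within
  a class the heights are distinct, which makes the starts a ladder system, and the rests are disjoint,
  which makes the infinite ones a disjoint family. The sum of these two, along the map from
  \<open>start A\<close> to \<open>rest A\<close>, then restores the sets \<open>f ` A\<close> up to the finite rests, which are omitted.

  The classes exist because of local smallness. Join \<open>A\<close> and \<open>B\<close> by an edge if they must not be in
  the same class. Suppose that \<open>B\<close> is a neighbour of a fixed \<open>A\<close>. If \<open>height B = height A\<close>, then \<open>f ` B\<close>
  has infinitely many points in the countable set of ordinals below \<open>height A\<close>. If \<open>rest B\<close> contains
  some \<open>y \<in> f ` A\<close>, then \<open>f ` B\<close> has infinitely many points in the countable set of ordinals below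
  \<open>y\<close>. There are countably many such \<open>y\<close>, so by local smallness \<open>A\<close> has countably many neighbours,
  and a graph of countable degree can be coloured with countably many colours
  (\<open>countable_degree_colouring\<close>, \<open>colouring_exists\<close>).

  One difficulty remains. Omitting the finite rests may lose points of the ground set, possibly
  uncountably many, and then \<open>f\<close> is no longer a bijection between the ground sets. Therefore each
  code \<open>y\<close> is also added to the ladder of one set \<open>pad y \<in> \<A>\<close> with \<open>y\<close> below \<open>height (pad y)\<close>, and
  different codes go to different sets. A ladder remains a ladder when a point below its height is
  added, and each set changes by a finite set only. Such an injective choice exists because, again by
  local smallness, only countably many \<open>A \<in> \<A>\<close> have \<open>height A\<close> at most \<open>y\<close> (\<open>padding_exists\<close>). By
  \<open>equivalent_families_mod_finite\<close> the resulting family is equivalent to \<open>\<A>\<close>.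
\<close>

section \<open>Equivalence of families by bijections modulo finite sets\<close>

lemma generated_algebra_least:
  assumes "algebra (\<Union>\<A>) M" "\<A> \<subseteq> M" "\<And>F. finite F \<Longrightarrow> F \<subseteq> \<Union>\<A> \<Longrightarrow> F \<in> M"
  shows "generated_algebra \<A> \<subseteq> M"
  unfolding generated_algebra_def using assms by (intro hull_minimal) auto

lemma generated_algebra_generators:
  shows "A \<in> \<A> \<Longrightarrow> A \<in> generated_algebra \<A>"
    and "finite F \<Longrightarrow> F \<subseteq> \<Union>\<A> \<Longrightarrow> F \<in> generated_algebra \<A>"
  using hull_subset[of "\<A> \<union> {F. finite F \<and> F \<subseteq> \<Union>\<A>}" "algebra (\<Union>\<A>)"]
  unfolding generated_algebra_def by auto

text \<open>
  Only nonempty intersections of algebras on a set are algebras on it. The hull is such an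
  intersection because the power set is one of the algebras that it is formed from.
\<close>

lemma algebra_generated_algebra: "algebra (\<Union>\<A>) (generated_algebra \<A>)"
proof -
  have Pow: "algebra (\<Union>\<A>) (Pow (\<Union>\<A>))"
    by (rule algebra_Pow)
  have "generated_algebra \<A> \<subseteq> Pow (\<Union>\<A>)"
    by (rule generated_algebra_least[OF Pow]) auto
  then show ?thesis
    unfolding algebra_iff_Un
    by (auto simp: generated_algebra_def hull_def algebra_iff_Un)
qed

lemma algebra_finite_change:
  assumes "algebra \<Omega> M" "\<And>F. finite F \<Longrightarrow> F \<subseteq> \<Omega> \<Longrightarrow> F \<in> M"
    and "X \<in> M" "Y \<subseteq> \<Omega>" "finite (sym_diff X Y)"
  shows "Y \<in> M"
proof -
  interpret algebra \<Omega> M by fact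
  have "X - Y \<in> M" "Y - X \<in> M"
    using assms sets_into_space[OF assms(3)] by (auto intro!: assms(2))
  then have "(X - (X - Y)) \<union> (Y - X) \<in> M"
    using assms(3) by blast
  also have "(X - (X - Y)) \<union> (Y - X) = Y" by blast
  finally show ?thesis .
qed

lemma algebra_vimage:
  assumes "algebra \<Omega>' N" "bij_betw f \<Omega> \<Omega>'"
  shows "algebra \<Omega> {X. X \<subseteq> \<Omega> \<and> f ` X \<in> N}"
proof -
  interpret algebra \<Omega>' N by fact
  have inj: "inj_on f \<Omega>" and im: "f ` \<Omega> = \<Omega>'"
    using assms(2) by (auto simp: bij_betw_def)
  have "f ` (\<Omega> - X) = \<Omega>' - f ` X" if "X \<subseteq> \<Omega>" for X
    using inj_on_image_set_diff[OF inj, of \<Omega> X] that im by auto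
  then show ?thesis
    by (auto simp: algebra_iff_Un image_Un)
qed

lemma algebra_image:
  assumes "algebra \<Omega> M" "bij_betw f \<Omega> \<Omega>'"
  shows "algebra \<Omega>' ((`) f ` M)"
proof -
  interpret algebra \<Omega> M by fact
  have inj: "inj_on f \<Omega>" and im: "f ` \<Omega> = \<Omega>'"
    using assms(2) by (auto simp: bij_betw_def)
  have "\<Omega>' - f ` X = f ` (\<Omega> - X)" if "X \<in> M" for X
    using inj_on_image_set_diff[OF inj, of \<Omega> X] sets_into_space[OF that] im by auto
  moreover have "(`) f ` M \<subseteq> Pow \<Omega>'"
    using im sets_into_space by blast
  ultimately show ?thesis
    unfolding algebra_iff_Un by (auto simp flip: image_Un)
qed

text \<open>
  The tool by which equivalence is established. As the generated algebra contains the finite sets,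
  it does not change when its generators are changed by finite sets. Hence a bijection of the ground
  sets that carries each generator to a generator modulo finite induces an isomorphism by taking
  images. It is essential that \<open>f\<close> maps onto the union of the new family.
\<close>

lemma equivalent_families_mod_finite:
  assumes ad: "countable_ad_family \<A>" and bij: "bij_betw f (\<Union>\<A>) (\<Union>(C ` \<A>))"
    and fin: "\<And>A. A \<in> \<A> \<Longrightarrow> finite (sym_diff (C A) (f ` A))"
  shows "equivalent_families \<A> (C ` \<A>)"
proof -
  let ?U = "\<Union>\<A>" and ?V = "\<Union>(C ` \<A>)"
  let ?M = "generated_algebra \<A>" and ?N = "generated_algebra (C ` \<A>)"
  have inj: "inj_on f ?U" and im: "f ` ?U = ?V"
    using bij by (auto simp: bij_betw_def)
  have CV: "C A \<subseteq> ?V" and fV: "f ` A \<subseteq> ?V" if "A \<in> \<A>" for A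
    using that im by blast+
  interpret M: algebra ?U ?M by (rule algebra_generated_algebra)
  interpret N: algebra ?V ?N by (rule algebra_generated_algebra)
  note N_finite = generated_algebra_generators(2)[of _ "C ` \<A>"]

  have "countable_ad_family (C ` \<A>)"
    unfolding countable_ad_family_def almost_disjoint_def pairwise_def
  proof (intro conjI ballI impI)
    fix X assume "X \<in> C ` \<A>"
    then obtain A where A: "A \<in> \<A>" "X = C A" by blast
    have "infinite (f ` A)"
      using A ad inj finite_imageD[of f A] inj_on_subset[OF inj, of A]
      by (auto simp: countable_ad_family_def almost_disjoint_def)
    moreover have "f ` A \<subseteq> X \<union> sym_diff (C A) (f ` A)"
      using A by auto
    ultimately show "infinite X"
      using fin[OF A(1)] by (meson finite_UnI finite_subset)
    have "countable (f ` A \<union> sym_diff (C A) (f ` A))"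
      using A ad fin[OF A(1)] countable_finite by (auto simp: countable_ad_family_def)
    then show "countable X"
      using A by (elim countable_subset[rotated]) auto
  next
    fix X Y assume "X \<in> C ` \<A>" "Y \<in> C ` \<A>" "X \<noteq> Y"
    then obtain A B where A: "A \<in> \<A>" "X = C A" and B: "B \<in> \<A>" "Y = C B" and "A \<noteq> B"
      by blast
    then have "finite (A \<inter> B)"
      using ad by (auto simp: countable_ad_family_def almost_disjoint_def pairwise_def)
    moreover have "f ` A \<inter> f ` B = f ` (A \<inter> B)"
      using inj_on_image_Int[OF inj, of A B] A B by auto
    ultimately have "finite (f ` A \<inter> f ` B \<union> sym_diff (C A) (f ` A) \<union> sym_diff (C B) (f ` B))"
      using fin A B by simp
    then show "finite (X \<inter> Y)"
      by (rule finite_subset[rotated]) (use A B in auto)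
  qed
  moreover
  have "f ` X \<in> ?N" if "X \<in> ?M" for X
  proof -
    have "?M \<subseteq> {X. X \<subseteq> ?U \<and> f ` X \<in> ?N}"
    proof (rule generated_algebra_least)
      show "algebra ?U {X. X \<subseteq> ?U \<and> f ` X \<in> ?N}"
        by (rule algebra_vimage[OF N.algebra_axioms bij])
      show "\<A> \<subseteq> {X. X \<subseteq> ?U \<and> f ` X \<in> ?N}"
      proof safe
        fix A assume A: "A \<in> \<A>"
        show "f ` A \<in> ?N"
          by (rule algebra_finite_change[OF N.algebra_axioms N_finite, of "C A"])
            (use A fV fin in \<open>auto intro: generated_algebra_generators\<close>)
      qed blast
      show "F \<in> {X. X \<subseteq> ?U \<and> f ` X \<in> ?N}" if "finite F" "F \<subseteq> ?U" for F
        using that image_mono[OF that(2), of f] im by (auto intro!: N_finite)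
    qed
    then show ?thesis using that by blast
  qed
  moreover
  have "?N \<subseteq> (`) f ` ?M"
  proof (rule generated_algebra_least)
    show alg: "algebra ?V ((`) f ` ?M)"
      by (rule algebra_image[OF M.algebra_axioms bij])
    show F: "F \<in> (`) f ` ?M" if "finite F" "F \<subseteq> ?V" for F
    proof -
      have "F \<subseteq> f ` ?U" using that im by simp
      then obtain G where "finite G" "G \<subseteq> ?U" "F = f ` G"
        using finite_subset_image[OF \<open>finite F\<close>] by metis
      then show ?thesis by (auto intro!: imageI generated_algebra_generators(2))
    qed
    show "C ` \<A> \<subseteq> (`) f ` ?M"
    proof safe
      fix A assume A: "A \<in> \<A>"
      show "C A \<in> (`) f ` ?M"
        by (rule algebra_finite_change[OF alg F, of "f ` A"])
          (use A CV fin in \<open>auto simp: Un_commute intro: generated_algebra_generators\<close>)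
    qed
  qed
  ultimately have ad': "countable_ad_family (C ` \<A>)" and MN: "(`) f ` ?M = ?N"
    by blast+
  have "inj_on ((`) f) ?M"
    by (rule inj_on_subset[OF inj_on_image_Pow[OF inj]]) (use M.sets_into_space in blast)
  then have "set_algebra_iso ((`) f) ?U ?M ?V ?N"
    unfolding set_algebra_iso_def
  proof (intro conjI ballI)
    show "bij_betw ((`) f) ?M ?N" if "inj_on ((`) f) ?M"
      using that MN by (simp add: bij_betw_def)
  next
    fix X Y assume X: "X \<in> ?M"
    show "f ` (?U - X) = ?V - f ` X"
      using inj_on_image_set_diff[OF inj, of ?U X] M.sets_into_space[OF X] im by auto
    assume Y: "Y \<in> ?M"
    show "f ` (X \<inter> Y) = f ` X \<inter> f ` Y"
      by (intro inj_on_image_Int[OF inj] M.sets_into_space X Y)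
  qed (use im in auto)
  then show ?thesis
    using ad ad' unfolding equivalent_families_def by blast
qed

lemma disjointifiable_if_disjoint:
  assumes "countable_ad_family \<A>" "disjoint \<A>"
  shows "disjointifiable \<A>"
proof -
  have "equivalent_families \<A> ((\<lambda>A. A) ` \<A>)"
    by (rule equivalent_families_mod_finite[where f = id]) (use assms in auto)
  then show ?thesis
    using assms(2) by (auto simp: disjointifiable_def)
qed

section \<open>Ladders and successors in a well-order\<close>

lemma (in wo_rel) not_le_imp_less:
  assumes "a \<in> Field r" "b \<in> Field r" "(a, b) \<notin> r"
  shows "b \<in> underS a"
  using assms TOTALS REFL by (auto simp: underS_def refl_on_def) 

lemma (in wo_rel) underS_trans: "a \<in> underS b \<Longrightarrow> (b, c) \<in> r \<Longrightarrow> a \<in> underS c"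
  using TRANS ANTISYM unfolding underS_def trans_def antisym_def by blast

lemma (in wo_rel) underS_trans2: "(a, b) \<in> r \<Longrightarrow> b \<in> underS c \<Longrightarrow> a \<in> underS c"
  using TRANS ANTISYM unfolding underS_def trans_def antisym_def by blast

text \<open>
  By comparability: if \<open>\<omega>\<close> were shorter than \<open>P\<close>, it would be isomorphic to a proper initial
  segment of \<open>P\<close>, but these are finite.
\<close>

lemma Restr_ordIso_natLeq:
  assumes wo: "Well_order r" and P: "P \<subseteq> Field r" "infinite P"
    and fin: "\<And>p. p \<in> P \<Longrightarrow> finite (P \<inter> underS r p)"
  shows "Restr r P =o natLeq"
proof -
  let ?R = "Restr r P"
  have R: "Well_order ?R" by (rule Well_order_Restr[OF wo])
  have F: "Field ?R = P"
    using Refl_Field_Restr[of r P] wo P(1) 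
    by (auto simp: well_order_on_def linear_order_on_def partial_order_on_def preorder_on_def)
  have "\<not> natLeq <o ?R"
  proof
    assume "natLeq <o ?R"
    then obtain a where a: "a \<in> P" and iso: "natLeq =o Restr ?R (underS ?R a)"
      using ordLess_iff_ordIso_Restr[OF R natLeq_Well_order] F by auto
    have "Field (Restr ?R (underS ?R a)) \<subseteq> P \<inter> underS r a"
      by (auto simp: Field_def underS_def)
    then have "finite (Field (Restr ?R (underS ?R a)))"
      using fin[OF a] finite_subset by blast
    moreover have "|Field natLeq| =o |Field (Restr ?R (underS ?R a))|"
      by (rule card_of_cong[OF iso])
    ultimately show False
      using card_of_ordIso_finite Field_natLeq by fastforce
  qed
  then have "?R \<le>o natLeq"
    using not_ordLess_iff_ordLeq[OF R natLeq_Well_order] by blast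
  moreover have "natLeq \<le>o |P|"
    using P(2) infinite_iff_natLeq_ordLeq by blast
  moreover have "|P| \<le>o ?R"
    using card_of_least[of P ?R] R F by metis
  ultimately show ?thesis
    using ordIso_iff_ordLeq ordLeq_transitive by blast
qed

text \<open>
  A criterion for ladders in terms of cardinality only: an infinite subset of \<open>l\<close> with finite
  traces below \<open>l\<close> has order type \<open>\<omega>\<close> and supremum \<open>l\<close>. The criterion is visibly preserved by adding finitely many points
  below \<open>l\<close>. That \<open>l\<close> has cofinality \<open>\<omega>\<close> comes for free: a finite cofinal set would cover
  \<open>P\<close> by finitely many finite traces.
\<close>

lemma (in wo_rel) ladderI:
  assumes P: "infinite P" "P \<subseteq> underS l" and l: "l \<in> Field r"
    and fin: "\<And>b. b \<in> underS l \<Longrightarrow> finite (P \<inter> under b)"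
  shows "l \<in> E_omega r" "Restr r P =o natLeq" "supr P = l"
proof -
  have PF: "P \<subseteq> Field r"
    using P(2) underS_Field by fastforce
  have above: "\<exists>p\<in>P. b \<in> underS p" if b: "b \<in> underS l" for b
  proof -
    have "\<not> P \<subseteq> under b"
      using fin[OF b] P(1) by (metis inf.absorb1)
    then obtain p where p: "p \<in> P" "(p, b) \<notin> r"
      by (auto simp: under_def)
    then show ?thesis
      using not_le_imp_less[of p b] PF b underS_Field[of _ r l] by blast
  qed
  show iso: "Restr r P =o natLeq"
  proof (rule Restr_ordIso_natLeq[OF WELL PF P(1)])
    fix p assume "p \<in> P"
    then have "finite (P \<inter> under p)" using fin P(2) by blast
    then show "finite (P \<inter> underS p)"
      by (rule finite_subset[rotated]) (auto simp: underS_def under_def)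
  qed
  have inf: "infinite C" if C: "cofinal_below r l C" for C
  proof
    assume "finite C"
    moreover have "finite (P \<inter> under c)" if "c \<in> C" for c
      using fin that C unfolding cofinal_below_def by blast
    ultimately have "finite (\<Union>c\<in>C. P \<inter> under c)" by blast
    moreover have "P \<subseteq> (\<Union>c\<in>C. P \<inter> under c)"
      using C P(2) unfolding cofinal_below_def under_def by blast
    ultimately show False
      using P(1) finite_subset by blast
  qed
  have "cofinal_below r l P"
    using P(2) above unfolding cofinal_below_def by (auto simp: underS_def)
  moreover have "|P| =o natLeq"
  proof -
    have "Field (Restr r P) = P"
      using Refl_Field_Restr[OF REFL] PF by auto
    then show ?thesis
      using card_of_cong[OF iso] Field_natLeq card_of_nat ordIso_transitive by metis
  qed
  ultimately show "l \<in> E_omega r"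
    using l inf infinite_iff_natLeq_ordLeq
    unfolding E_omega_def has_cofinality_def by blast
  have lA: "l \<in> Above P"
    using P(2) l by (auto simp: Above_def underS_def)
  moreover have "Above P \<subseteq> Field r"
    by (auto simp: Above_def)
  ultimately have S: "supr P \<in> Above P" and "(supr P, l) \<in> r"
    unfolding supr_def using minim_in[of "Above P"] minim_least[of "Above P" l] by auto
  show "supr P = l"
  proof (rule ccontr)
    assume "supr P \<noteq> l"
    then have "supr P \<in> underS l"
      using \<open>(supr P, l) \<in> r\<close> by (auto simp: underS_def)
    then obtain p where "p \<in> P" "supr P \<in> underS p"
      using above by blast
    then show False
      using S ANTISYM unfolding Above_def underS_def antisym_def by blast
  qed
qed

text \<open>
  A successor has a cofinal set with one element.
\<close>

lemma (in wo_rel) suc_singleton_notin_E_omega: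
  assumes "a \<in> Field r" "AboveS {a} \<noteq> {}"
  shows "suc {a} \<notin> E_omega r"
proof
  assume "suc {a} \<in> E_omega r"
  moreover have "cofinal_below r (suc {a}) {a}"
    unfolding cofinal_below_def
  proof (intro conjI ballI)
    show a: "{a} \<subseteq> underS (suc {a})"
      using suc_greater[of "{a}" a] assms by (auto simp: underS_def)
    fix b assume b: "b \<in> underS (suc {a})"
    have "(b, a) \<in> r"
    proof (rule ccontr)
      assume "(b, a) \<notin> r"
      then have "a \<in> underS b"
        using not_le_imp_less[of b a] b assms(1) underS_Field[of b r] by blast
      then have "b \<in> AboveS {a}"
        using b underS_Field[of b r] by (auto simp: AboveS_def underS_def)
      then have "(suc {a}, b) \<in> r" by (rule suc_least_AboveS)
      then show False
        using b ANTISYM unfolding underS_def antisym_def by blast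
    qed
    then show "\<exists>c\<in>{a}. (b, c) \<in> r" by simp
  qed
  ultimately have "natLeq \<le>o |{a}|"
    unfolding E_omega_def has_cofinality_def by blast
  then show False
    using infinite_iff_natLeq_ordLeq by blast
qed

text \<open>
  For infinite \<open>Q\<close> these are the first \<open>\<omega>\<close> elements of \<open>Q\<close>, the initial segment of order
  type \<open>\<omega>\<close>.
\<close>
definition first_omega :: "'o rel \<Rightarrow> 'o set \<Rightarrow> 'o set" where
  "first_omega \<kappa> Q = {q \<in> Q. finite (Q \<inter> underS \<kappa> q)}"

text \<open>
  Otherwise consider the least element of \<open>Q\<close> not among the first ones: all its predecessors in
  \<open>Q\<close> are among the first ones, so they are finite in number, and it is a first one itself.
\<close>

lemma (in wo_rel) infinite_first_omega:
  assumes "infinite Q" "Q \<subseteq> Field r"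
  shows "infinite (first_omega r Q)"
proof
  assume fin: "finite (first_omega r Q)"
  define M where "M = Q - first_omega r Q"
  have "M \<noteq> {}"
    using assms(1) fin finite_subset[of Q "first_omega r Q"] by (auto simp: M_def)
  moreover have MF: "M \<subseteq> Field r"
    using assms(2) by (auto simp: M_def)
  ultimately have m: "minim M \<in> M"
    by (intro minim_in)
  have "Q \<inter> underS (minim M) \<subseteq> first_omega r Q"
  proof
    fix q assume q: "q \<in> Q \<inter> underS (minim M)"
    then have "q \<notin> M"
      using minim_least[OF MF, of q] ANTISYM by (auto simp: underS_def antisym_def)
    then show "q \<in> first_omega r Q"
      using q by (auto simp: M_def)
  qed
  then have "finite (Q \<inter> underS (minim M))"
    using fin finite_subset by blast
  then show False
    using m by (auto simp: M_def first_omega_def)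
qed

text \<open>
  These are the hypotheses of the criterion for ladders, so the first \<open>\<omega>\<close> elements of any infinite
  bounded set form a ladder at their supremum, apart from the demand that ladders avoid ordinals of
  cofinality \<open>\<omega>\<close>. The supremum is not attained, since each element has finitely many predecessors
  in an infinite set.
\<close>

lemma (in wo_rel) first_omega_cofinal_in_supr:
  fixes Q :: "'a set"
  defines "P \<equiv> first_omega r Q"
  assumes Q: "infinite Q" "Q \<subseteq> Field r" and above: "Above P \<noteq> {}"
  shows "supr P \<in> Field r" "P \<subseteq> underS (supr P)"
    "\<And>b. b \<in> underS (supr P) \<Longrightarrow> finite (P \<inter> under b)"
proof -
  have P: "infinite P" "P \<subseteq> Q"
    using infinite_first_omega[OF Q] by (auto simp: P_def first_omega_def)
  have AF: "Above P \<subseteq> Field r"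
    by (auto simp: Above_def)
  have S: "supr P \<in> Above P"
    unfolding supr_def using AF above by (rule minim_in)
  then show SF: "supr P \<in> Field r"
    using AF by blast
  have fin: "finite (P \<inter> underS p)" if "p \<in> P" for p
    using that unfolding P_def first_omega_def by (auto elim: finite_subset[rotated])
  have "supr P \<notin> P"
  proof
    assume "supr P \<in> P"
    then have "finite (insert (supr P) (P \<inter> underS (supr P)))"
      using fin by blast
    moreover have "P \<subseteq> insert (supr P) (P \<inter> underS (supr P))"
      using S by (auto simp: Above_def underS_def)
    ultimately show False
      using P(1) finite_subset by blast
  qed
  then show "P \<subseteq> underS (supr P)"
    using S by (auto simp: Above_def underS_def)
  fix b assume b: "b \<in> underS (supr P)"
  then have bF: "b \<in> Field r"
    using underS_Field[of b r] by blast
  have "b \<notin> Above P"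
  proof
    assume "b \<in> Above P"
    then have "(supr P, b) \<in> r"
      unfolding supr_def by (rule minim_least[OF AF])
    then show False
      using b ANTISYM by (auto simp: underS_def antisym_def)
  qed
  then obtain p where p: "p \<in> P" "(p, b) \<notin> r"
    using bF by (auto simp: Above_def)
  then have "b \<in> underS p"
    using not_le_imp_less[of p b] P(2) Q(2) bF by blast
  then have "P \<inter> under b \<subseteq> P \<inter> underS p"
    using underS_trans2 by (auto simp: under_def)
  then show "finite (P \<inter> under b)"
    using fin[OF p(1)] finite_subset by blast
qed

section \<open>The first uncountable cardinal\<close>

lemma wo_rel_omega1: "wo_rel omega1"
  unfolding wo_rel_def by (rule cardSuc_Well_order[OF natLeq_Card_order])

interpretation omega1: wo_rel omega1
  by (rule wo_rel_omega1)

lemma countable_underS_omega1: "countable (underS omega1 a)"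
proof (cases "a \<in> Field omega1")
  case True
  have "|underS omega1 a| <o omega1"
    by (rule card_of_underS[OF cardSuc_Card_order[OF natLeq_Card_order] True])
  then have "|underS omega1 a| \<le>o natLeq"
    using cardSuc_ordLeq_ordLess[OF natLeq_Card_order card_of_Card_order] by blast
  then show ?thesis
    by (simp add: countable_card_le_natLeq)
next
  case False
  then have "underS omega1 a = {}"
    by (auto simp: underS_def Field_def)
  then show ?thesis by simp
qed

lemma uncountable_if_ordIso_omega1:
  assumes "|A| =o omega1"
  shows "uncountable A"
proof
  assume "countable A"
  then have "|A| \<le>o natLeq"
    by (simp add: countable_card_le_natLeq)
  moreover have "natLeq <o |A|"
    using cardSuc_greater[OF natLeq_Card_order] assms ordIso_symmetric ordLess_ordIso_trans by blast
  ultimately show False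
    using not_ordLess_ordLeq by blast
qed

lemma uncountable_Field_omega1: "uncountable (Field omega1)"
  by (rule uncountable_if_ordIso_omega1)
    (rule card_of_Field_ordIso[OF cardSuc_Card_order[OF natLeq_Card_order]])

lemma AboveS_omega1_nonempty:
  assumes "countable P" "P \<subseteq> Field omega1"
  shows "AboveS omega1 P \<noteq> {}"
proof
  assume empty: "AboveS omega1 P = {}"
  have "Field omega1 \<subseteq> (\<Union>p\<in>P. insert p (underS omega1 p))"
  proof
    fix a assume a: "a \<in> Field omega1"
    then obtain p where p: "p \<in> P" "a = p \<or> (p, a) \<notin> omega1"
      using empty by (auto simp: AboveS_def)
    then show "a \<in> (\<Union>p\<in>P. insert p (underS omega1 p))"
      using omega1.not_le_imp_less[of p a] a assms(2) by auto
  qed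
  moreover have "countable (\<Union>p\<in>P. insert p (underS omega1 p))"
    using assms(1) countable_underS_omega1 by auto
  ultimately show False
    using uncountable_Field_omega1 countable_subset by blast
qed

lemma Above_omega1_nonempty:
  assumes "countable P" "P \<subseteq> Field omega1"
  shows "Above omega1 P \<noteq> {}"
  using AboveS_omega1_nonempty[OF assms] by (auto simp: Above_def AboveS_def)

lemma inj_on_suc_omega1: "inj_on (\<lambda>a. omega1.suc {a}) (Field omega1)"
proof -
  have less: "omega1.suc {a} \<noteq> omega1.suc {b}"
    if "a \<in> Field omega1" "b \<in> Field omega1" "a \<in> underS omega1 b" for a b
  proof -
    have "b \<in> AboveS omega1 {a}"
      using that by (auto simp: AboveS_def underS_def)
    then have "(omega1.suc {a}, b) \<in> omega1"
      by (rule omega1.suc_least_AboveS)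
    moreover have "omega1.suc {b} \<noteq> b" "(b, omega1.suc {b}) \<in> omega1"
      using omega1.suc_greater[of "{b}" b] AboveS_omega1_nonempty[of "{b}"] that by auto
    ultimately show ?thesis
      using omega1.ANTISYM by (metis antisymD)
  qed
  show ?thesis
  proof (rule inj_onI, rule ccontr)
    fix a b assume ab: "a \<in> Field omega1" "b \<in> Field omega1"
      and eq: "omega1.suc {a} = omega1.suc {b}" and "a \<noteq> b"
    then have "a \<in> underS omega1 b \<or> b \<in> underS omega1 a"
      using omega1.TOTALS by (auto simp: underS_def)
    then show False
      using less[of a b] less[of b a] ab eq by auto
  qed
qed

text \<open>
  Since ladders must avoid ordinals of cofinality \<open>\<omega>\<close>, the ground set is coded by successors.
\<close>

lemma injection_into_successors:
  assumes "|U| \<le>o omega1"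
  obtains f where "inj_on f U" "f ` U \<subseteq> Field omega1 - E_omega omega1"
proof -
  have "|U| \<le>o |Field omega1|"
    using assms card_of_Field_ordIso[OF cardSuc_Card_order[OF natLeq_Card_order]]
      ordIso_symmetric ordLeq_ordIso_trans by blast
  then obtain g where g: "inj_on g U" "g ` U \<subseteq> Field omega1"
    unfolding card_of_ordLeq[symmetric] by blast
  show thesis
  proof (rule that)
    show "inj_on ((\<lambda>a. omega1.suc {a}) \<circ> g) U"
      by (rule comp_inj_on[OF g(1) inj_on_subset[OF inj_on_suc_omega1 g(2)]])
    show "((\<lambda>a. omega1.suc {a}) \<circ> g) ` U \<subseteq> Field omega1 - E_omega omega1"
    proof safe
      fix u assume "u \<in> U"
      then have gu: "g u \<in> Field omega1" using g(2) by blast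
      have above: "AboveS omega1 {g u} \<noteq> {}"
        by (rule AboveS_omega1_nonempty) (use gu in auto)
      show "((\<lambda>a. omega1.suc {a}) \<circ> g) u \<in> Field omega1"
        using omega1.suc_inField[of "{g u}"] above gu by simp
      assume "((\<lambda>a. omega1.suc {a}) \<circ> g) u \<in> E_omega omega1"
      then show False
        using omega1.suc_singleton_notin_E_omega[OF gu above] by simp
    qed
  qed
qed

text \<open>
  Choose by recursion: fewer than \<open>\<omega>\<^sub>1\<close>, hence countably many values are taken at each stage.
\<close>

lemma injective_choice_omega1:
  assumes "\<And>y. y \<in> Field omega1 \<Longrightarrow> uncountable (T y)"
  obtains g where "inj_on g (Field omega1)" "\<And>y. y \<in> Field omega1 \<Longrightarrow> g y \<in> T y"
proof -
  have "\<exists>g. \<forall>y. y \<in> Field omega1 \<longrightarrow> g y \<in> T y - g ` underS omega1 y"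
  proof (rule dependent_wf_choice[where R = "omega1 - Id" and
        P = "\<lambda>g y t. y \<in> Field omega1 \<longrightarrow> t \<in> T y - g ` underS omega1 y"])
    show "wf (omega1 - Id)"
      by (rule omega1.WF)
    fix f g :: "nat set \<Rightarrow> 'a" and y t
    assume "\<And>z. (z, y) \<in> omega1 - Id \<Longrightarrow> f z = g z"
    then have "f ` underS omega1 y = g ` underS omega1 y"
      by (intro image_cong) (auto simp: underS_def)
    then show "(y \<in> Field omega1 \<longrightarrow> t \<in> T y - f ` underS omega1 y) =
        (y \<in> Field omega1 \<longrightarrow> t \<in> T y - g ` underS omega1 y)"
      by simp
  next
    fix y and g :: "nat set \<Rightarrow> 'a"
    have "countable (g ` underS omega1 y)"
      by (intro countable_image countable_underS_omega1)
    then have "T y - g ` underS omega1 y \<noteq> {}" if "y \<in> Field omega1"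
      using assms[OF that] by (metis Diff_eq_empty_iff countable_subset)
    then show "\<exists>t. y \<in> Field omega1 \<longrightarrow> t \<in> T y - g ` underS omega1 y"
      by blast
  qed
  then obtain g where g: "\<And>y. y \<in> Field omega1 \<Longrightarrow> g y \<in> T y - g ` underS omega1 y"
    by blast
  show thesis
  proof (rule that)
    show "inj_on g (Field omega1)"
    proof (rule inj_onI, rule ccontr)
      fix a b assume ab: "a \<in> Field omega1" "b \<in> Field omega1" and "g a = g b" "a \<noteq> b"
      moreover from this have "a \<in> underS omega1 b \<or> b \<in> underS omega1 a"
        using omega1.TOTALS by (auto simp: underS_def)
      ultimately show False
        using g[OF ab(1)] g[OF ab(2)] by (metis DiffD2 imageI)
    qed
  qed (use g in blast)
qed

section \<open>Colouring graphs of countable degree\<close>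

text \<open>
  The connected components are countable, so each of them can be coloured injectively.
\<close>

lemma countable_degree_colouring:
  assumes sym: "sym N" and deg: "\<And>a. countable (N `` {a})"
  obtains e :: "'a \<Rightarrow> nat" where "\<And>a b. (a, b) \<in> N \<Longrightarrow> a \<noteq> b \<Longrightarrow> e a \<noteq> e b"
proof -
  have Image: "N `` S = (\<Union>s\<in>S. N `` {s})" for S
    by blast
  have "countable ((N ^^ n) `` {a})" for n a
  proof (induction n)
    case (Suc n)
    have "(N ^^ Suc n) `` {a} = N `` ((N ^^ n) `` {a})"
      by auto
    also have "countable \<dots>"
      using Suc deg by (subst Image) auto
    finally show ?case .
  qed simp
  moreover have "N\<^sup>* `` {a} = (\<Union>n. (N ^^ n) `` {a})" for a
    by (auto simp: rtrancl_is_UN_relpow)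
  ultimately have comp: "countable (N\<^sup>* `` {a})" for a
    by simp
  show thesis
  proof (rule that[of "\<lambda>a. to_nat_on (N\<^sup>* `` {a}) a"])
    fix a b assume ab: "(a, b) \<in> N" "a \<noteq> b"
    then have "(b, a) \<in> N"
      using sym by (auto dest: symD)
    \<comment> \<open>adjacent points number the same component\<close>
    then have eq: "N\<^sup>* `` {a} = N\<^sup>* `` {b}"
      using ab(1) by (auto intro: converse_rtrancl_into_rtrancl)
    have "a \<in> N\<^sup>* `` {b}" "b \<in> N\<^sup>* `` {b}"
      using \<open>(b, a) \<in> N\<close> by auto
    then show "to_nat_on (N\<^sup>* `` {a}) a \<noteq> to_nat_on (N\<^sup>* `` {b}) b"
      using inj_on_to_nat_on[OF comp, of b] ab(2) unfolding eq by (auto dest: inj_onD)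
  qed
qed

section \<open>Splitting the coded sets\<close>

locale successor_coding =
  fixes \<A> :: "'a set set" and f :: "'a \<Rightarrow> nat set"
  assumes family: "countable_ad_family \<A>"
    and small: "locally_small \<A>"
    and inj_f: "inj_on f (\<Union>\<A>)"
    and f_range: "f ` \<Union>\<A> \<subseteq> Field omega1 - E_omega omega1"
begin

definition start :: "'a set \<Rightarrow> nat set set" where
  "start A = first_omega omega1 (f ` A)"

definition height :: "'a set \<Rightarrow> nat set" where
  "height A = omega1.supr (start A)"

definition rest :: "'a set \<Rightarrow> nat set set" where
  "rest A = f ` A - start A"

lemma code:
  assumes "A \<in> \<A>"
  shows infinite_code: "infinite (f ` A)" and countable_code: "countable (f ` A)"
    and code_subset: "f ` A \<subseteq> Field omega1 - E_omega omega1"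
proof -
  have "inj_on f A"
    by (rule inj_on_subset[OF inj_f]) (use assms in blast)
  then show "infinite (f ` A)" "countable (f ` A)"
    using assms family finite_imageD
    by (auto simp: countable_ad_family_def almost_disjoint_def)
qed (use assms f_range in auto)

lemma finite_code_Int:
  assumes "A \<in> \<A>" "B \<in> \<A>" "A \<noteq> B"
  shows "finite (f ` A \<inter> f ` B)"
proof -
  have "finite (A \<inter> B)"
    using assms family
    by (auto simp: countable_ad_family_def almost_disjoint_def pairwise_def)
  moreover have "f ` A \<inter> f ` B = f ` (A \<inter> B)"
    using inj_on_image_Int[OF inj_f, of A B] assms by auto
  ultimately show ?thesis by simp
qed

lemma countable_infinite_code_Int:
  assumes "countable D"
  shows "countable {A \<in> \<A>. infinite (f ` A \<inter> D)}"
proof -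
  have "countable (f -` D \<inter> \<Union>\<A>)"
  proof (rule countable_image_inj_on)
    show "countable (f ` (f -` D \<inter> \<Union>\<A>))"
      by (rule countable_subset[OF _ assms]) blast
    show "inj_on f (f -` D \<inter> \<Union>\<A>)"
      using inj_f by (rule inj_on_subset) blast
  qed
  then have "countable {A \<in> \<A>. infinite (A \<inter> (f -` D \<inter> \<Union>\<A>))}"
    using small by (simp add: locally_small_def)
  then show ?thesis
  proof (rule countable_subset[rotated], safe)
    fix A assume "A \<in> \<A>" "infinite (f ` A \<inter> D)" "finite (A \<inter> (f -` D \<inter> \<Union>\<A>))"
    moreover have "f ` A \<inter> D \<subseteq> f ` (A \<inter> (f -` D \<inter> \<Union>\<A>))"
      using \<open>A \<in> \<A>\<close> by blast
    ultimately show False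
      using finite_surj by blast
  qed
qed

lemma start_subset: "start A \<subseteq> f ` A"
  by (auto simp: start_def first_omega_def)

lemma start:
  assumes A: "A \<in> \<A>"
  shows infinite_start: "infinite (start A)"
    and height_Field: "height A \<in> Field omega1"
    and start_below_height: "start A \<subseteq> underS omega1 (height A)"
    and finite_start_below: "b \<in> underS omega1 (height A) \<Longrightarrow> finite (start A \<inter> under omega1 b)"
proof -
  have F: "f ` A \<subseteq> Field omega1"
    using code_subset[OF A] by blast
  show "infinite (start A)"
    unfolding start_def by (rule omega1.infinite_first_omega[OF infinite_code[OF A] F])
  have "Above omega1 (start A) \<noteq> {}"
    using start_subset[of A] countable_code[OF A] F countable_subset
    by (intro Above_omega1_nonempty) blast+
  note * = omega1.first_omega_cofinal_in_supr[OF infinite_code[OF A] F this[unfolded start_def]]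
  show "height A \<in> Field omega1" "start A \<subseteq> underS omega1 (height A)"
    "b \<in> underS omega1 (height A) \<Longrightarrow> finite (start A \<inter> under omega1 b)"
    using * unfolding height_def start_def by auto
qed

lemma infinite_code_below_rest:
  assumes "y \<in> rest A"
  shows "infinite (f ` A \<inter> underS omega1 y)"
  using assms by (auto simp: rest_def start_def first_omega_def)

text \<open>
  A point of \<open>f ` A\<close> below \<open>height A\<close> is exceeded by an element of \<open>start A\<close>, so it has finitely
  many predecessors in \<open>f ` A\<close> and belongs to \<open>start A\<close> itself.
\<close>

lemma rest_not_below_height:
  assumes A: "A \<in> \<A>"
  shows "rest A \<inter> underS omega1 (height A) = {}"
proof safe
  fix y assume y: "y \<in> rest A" "y \<in> underS omega1 (height A)"
  have "\<not> start A \<subseteq> under omega1 y"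
    using infinite_start[OF A] finite_start_below[OF A y(2)] by (metis inf.absorb1)
  then obtain p where p: "p \<in> start A" "(p, y) \<notin> omega1"
    by (auto simp: under_def)
  have "y \<in> underS omega1 p"
    using omega1.not_le_imp_less[of p y] p start_subset[of A] code_subset[OF A] y(1)
    by (auto simp: rest_def)
  then have "(y, p) \<in> omega1"
    by (simp add: underS_def)
  then have "f ` A \<inter> underS omega1 y \<subseteq> f ` A \<inter> underS omega1 p"
    using omega1.underS_trans by blast
  moreover have "finite (f ` A \<inter> underS omega1 p)"
    using p(1) by (simp add: start_def first_omega_def)
  ultimately have "finite (f ` A \<inter> underS omega1 y)"
    by (rule finite_subset)
  then show "y \<in> {}"
    using infinite_code_below_rest[OF y(1)] by blast
qed

text \<open>
  If \<open>height A\<close> is at most \<open>y\<close>, then \<open>start A\<close> is an infinite subset of the countable set of ordinals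
  below \<open>y\<close>, which happens for countably many \<open>A\<close> only. So uncountably many values are admissible
  at each \<open>y\<close>.
\<close>

lemma padding_exists:
  assumes "uncountable \<A>"
  obtains pad where "inj_on pad (Field omega1)"
    "\<And>y. y \<in> Field omega1 \<Longrightarrow> pad y \<in> {A \<in> \<A>. y \<in> underS omega1 (height A)}"
proof -
  have "uncountable {A \<in> \<A>. y \<in> underS omega1 (height A)}" if y: "y \<in> Field omega1" for y
  proof
    assume "countable {A \<in> \<A>. y \<in> underS omega1 (height A)}"
    moreover have "countable {A \<in> \<A>. infinite (f ` A \<inter> underS omega1 y)}"
      by (rule countable_infinite_code_Int[OF countable_underS_omega1])
    moreover have "\<A> \<subseteq> {A \<in> \<A>. y \<in> underS omega1 (height A)} \<union>
        {A \<in> \<A>. infinite (f ` A \<inter> underS omega1 y)}"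
    proof safe
      fix A assume A: "A \<in> \<A>" and fin: "finite (f ` A \<inter> underS omega1 y)"
      show "y \<in> underS omega1 (height A)"
      proof (rule ccontr)
        assume "y \<notin> underS omega1 (height A)"
        then have "(height A, y) \<in> omega1"
          using omega1.not_le_imp_less[OF height_Field[OF A] y] by blast
        then have "start A \<subseteq> f ` A \<inter> underS omega1 y"
          using start_subset start_below_height[OF A] omega1.underS_trans by blast
        then show False
          using fin infinite_start[OF A] finite_subset by blast
      qed
    qed
    ultimately have "countable \<A>"
      using countable_subset by (metis (no_types, lifting) countable_Un)
    then show False
      using assms by blast
  qed
  then show thesis
    using injective_choice_omega1[of "\<lambda>y. {A \<in> \<A>. y \<in> underS omega1 (height A)}"] that by blast
qed

text \<open>
  The graph of conflicts has countable degree: each neighbour of \<open>A\<close> has an infinite trace below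
  \<open>height A\<close> or below some element of \<open>f ` A\<close>, by the definition of \<open>rest\<close>, and local smallness
  applies to these countably many initial segments.
\<close>

lemma colouring_exists:
  obtains e :: "'a set \<Rightarrow> nat" where
    "\<And>A B. A \<in> \<A> \<Longrightarrow> B \<in> \<A> \<Longrightarrow> e A = e B \<Longrightarrow> A \<noteq> B \<Longrightarrow> height A \<noteq> height B \<and> rest A \<inter> rest B = {}"
proof -
  define N where
    "N = {(A, B). A \<in> \<A> \<and> B \<in> \<A> \<and> (height A = height B \<or> rest A \<inter> rest B \<noteq> {})}"
  have "sym N"
    by (auto simp: N_def sym_def)
  moreover have "countable (N `` {A})" for A
  proof (cases "A \<in> \<A>")
    case True
    let ?D = "\<lambda>y. {B \<in> \<A>. infinite (f ` B \<inter> underS omega1 y)}"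
    have "N `` {A} \<subseteq> ?D (height A) \<union> (\<Union>y\<in>f ` A. ?D y)"
    proof
      fix B assume "B \<in> N `` {A}"
      then have B: "B \<in> \<A>" and "height A = height B \<or> rest A \<inter> rest B \<noteq> {}"
        by (auto simp: N_def)
      then consider "height A = height B" | y where "y \<in> rest A" "y \<in> rest B"
        by blast
      then show "B \<in> ?D (height A) \<union> (\<Union>y\<in>f ` A. ?D y)"
      proof cases
        case 1
        then have "start B \<subseteq> f ` B \<inter> underS omega1 (height A)"
          using start_below_height[OF B] start_subset[of B] by auto
        then have "infinite (f ` B \<inter> underS omega1 (height A))"
          using infinite_start[OF B] finite_subset by metis
        then show ?thesis using B by blast
      next
        case 2
        have "y \<in> f ` A"
          using 2(1) by (auto simp: rest_def)
        moreover have "infinite (f ` B \<inter> underS omega1 y)"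
          using 2(2) by (rule infinite_code_below_rest)
        ultimately show ?thesis using B by blast
      qed
    qed
    moreover have "countable (?D (height A) \<union> (\<Union>y\<in>f ` A. ?D y))"
      by (intro countable_Un countable_UN countable_code[OF True] countable_infinite_code_Int
          countable_underS_omega1)
    ultimately show ?thesis by (rule countable_subset)
  next
    case False
    then have "N `` {A} = {}" by (auto simp: N_def)
    then show ?thesis by simp
  qed
  ultimately obtain e :: "'a set \<Rightarrow> nat" where "\<And>A B. (A, B) \<in> N \<Longrightarrow> A \<noteq> B \<Longrightarrow> e A \<noteq> e B"
    using countable_degree_colouring by blast
  then show thesis
    by (intro that[of e]) (auto simp: N_def)
qed

end

section \<open>The ladder systems and the disjoint families\<close>

locale padded_coding = successor_coding +
  fixes pad :: "nat set \<Rightarrow> 'a set" and e :: "'a set \<Rightarrow> nat"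
  assumes inj_pad: "inj_on pad (Field omega1)"
    and pad: "\<And>y. y \<in> Field omega1 \<Longrightarrow> pad y \<in> {A \<in> \<A>. y \<in> underS omega1 (height A)}"
    and e: "\<And>A B. A \<in> \<A> \<Longrightarrow> B \<in> \<A> \<Longrightarrow> e A = e B \<Longrightarrow> A \<noteq> B \<Longrightarrow>
      height A \<noteq> height B \<and> rest A \<inter> rest B = {}"
begin

definition ladder :: "'a set \<Rightarrow> nat set set" where
  "ladder A = start A \<union> {y \<in> f ` \<Union>\<A>. pad y = A}"

definition colour_class :: "nat \<Rightarrow> 'a set set" where
  "colour_class n = {A \<in> \<A>. e A = n}"

text \<open>
  The sets whose rest is infinite; only these rests can be members of an almost disjoint family, and
  the others are negligible.
\<close>

definition long_class :: "nat \<Rightarrow> 'a set set" where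
  "long_class n = {A \<in> colour_class n. infinite (rest A)}"

lemma colour_classD:
  assumes "A \<in> colour_class n"
  shows "A \<in> \<A>" "e A = n"
  using assms by (auto simp: colour_class_def)

lemma long_classD:
  assumes "A \<in> long_class n"
  shows "A \<in> colour_class n" "A \<in> \<A>" "infinite (rest A)"
  using assms by (auto simp: long_class_def colour_class_def)

lemma finite_padding: "finite {y \<in> f ` \<Union>\<A>. pad y = A}"
proof (cases "\<exists>y \<in> f ` \<Union>\<A>. pad y = A")
  case True
  then obtain y where "y \<in> f ` \<Union>\<A>" "pad y = A" by blast
  then have "{y \<in> f ` \<Union>\<A>. pad y = A} \<subseteq> {y}"
    using inj_onD[OF inj_pad] f_range by blast
  then show ?thesis by (rule finite_subset) simp
next
  case False
  then have "{y \<in> f ` \<Union>\<A>. pad y = A} = {}" by blast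
  then show ?thesis by (metis finite.emptyI)
qed

lemma finite_ladder_minus_code: "finite (ladder A - f ` A)"
  by (rule finite_subset[OF _ finite_padding[of A]])
    (use start_subset[of A] in \<open>auto simp: ladder_def\<close>)

lemma ladder:
  assumes A: "A \<in> \<A>"
  shows infinite_ladder: "infinite (ladder A)"
    and ladder_below_height: "ladder A \<subseteq> underS omega1 (height A)"
    and ladder_subset: "ladder A \<subseteq> f ` \<Union>\<A>"
    and height_E_omega: "height A \<in> E_omega omega1"
    and ladder_type: "Restr omega1 (ladder A) =o natLeq"
    and supr_ladder: "omega1.supr (ladder A) = height A"
proof -
  show L: "infinite (ladder A)"
    using infinite_start[OF A] by (simp add: ladder_def)
  show "ladder A \<subseteq> f ` \<Union>\<A>"
    using start_subset[of A] A unfolding ladder_def by blast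
  show below: "ladder A \<subseteq> underS omega1 (height A)"
    unfolding ladder_def
  proof (rule Un_least[OF start_below_height[OF A]], rule subsetI)
    fix y assume "y \<in> {y \<in> f ` \<Union>\<A>. pad y = A}"
    then show "y \<in> underS omega1 (height A)"
      using pad[of y] f_range by blast
  qed
  have "finite (ladder A \<inter> under omega1 b)" if "b \<in> underS omega1 (height A)" for b
    using finite_start_below[OF A that] finite_padding[of A]
    unfolding ladder_def Int_Un_distrib2 by blast
  note * = omega1.ladderI[OF L below height_Field[OF A] this]
  show "height A \<in> E_omega omega1" "Restr omega1 (ladder A) =o natLeq"
    "omega1.supr (ladder A) = height A"
    by (rule *, assumption)+
qed

lemma inj_on_height: "inj_on height (colour_class n)"
  using e by (intro inj_onI) (metis colour_classD)

lemma inj_on_ladder: "inj_on ladder (colour_class n)"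
proof (rule inj_onI)
  fix A B assume AB: "A \<in> colour_class n" "B \<in> colour_class n" "ladder A = ladder B"
  then have "height A = height B"
    using supr_ladder colour_classD(1) by metis
  then show "A = B"
    using inj_on_height AB by (meson inj_onD)
qed

lemma ladder_family_colour_class: "ladder_family omega1 (ladder ` colour_class n)"
  unfolding ladder_family_def
proof (intro exI conjI)
  let ?S = "height ` colour_class n" and ?L = "\<lambda>a. ladder (the_inv_into (colour_class n) height a)"
  have inv: "the_inv_into (colour_class n) height (height A) = A" if "A \<in> colour_class n" for A
    by (rule the_inv_into_f_f[OF inj_on_height that])
  show "ladder ` colour_class n = ?L ` ?S"
    by (simp add: image_image inv cong: image_cong_simp)
  show "ladder_system omega1 ?S ?L"
    unfolding ladder_system_def
  proof (intro conjI ballI subsetI)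
    fix a assume "a \<in> ?S"
    then show "a \<in> E_omega omega1"
      using height_E_omega colour_classD by blast
  next
    fix a assume "a \<in> ?S"
    then obtain A where A: "A \<in> colour_class n" "a = height A" by blast
    note A' = colour_classD(1)[OF A(1)]
    show "Restr omega1 (?L a) =o natLeq" "omega1.supr (?L a) = a"
      using ladder_type supr_ladder A' by (auto simp: A(2) inv[OF A(1)])
    fix y assume "y \<in> ?L a"
    then have "y \<in> ladder A" by (simp add: A(2) inv[OF A(1)])
    then show "y \<in> Field omega1 - E_omega omega1" "y \<in> underS omega1 a"
      using ladder_below_height[OF A'] ladder_subset[OF A'] f_range A(2) by blast+
  qed
qed

lemma disjointifiable_rests: "disjointifiable (rest ` long_class n)"
proof (rule disjointifiable_if_disjoint)
  have "rest A \<inter> rest B = {}" if "A \<in> long_class n" "B \<in> long_class n" "rest A \<noteq> rest B" for A B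
  proof -
    have "A \<noteq> B" "e A = e B"
      using that long_classD(1) colour_classD(2) by metis+
    then show ?thesis
      using e long_classD(2) that by blast
  qed
  then show "disjoint (rest ` long_class n)"
    by (auto simp: disjoint_def)
  then show "countable_ad_family (rest ` long_class n)"
    unfolding countable_ad_family_def almost_disjoint_def
  proof (intro conjI ballI)
    show "pairwise (\<lambda>X Y. finite (X \<inter> Y)) (rest ` long_class n)"
      if "disjoint (rest ` long_class n)"
      using that by (auto simp: pairwise_def disjoint_def disjnt_def)
    show "countable X" if "X \<in> rest ` long_class n" for X
      using that long_classD(2) countable_code countable_subset by (auto simp: rest_def)
  qed (use long_classD(3) in blast)
qed

definition rest_of_ladder :: "nat \<Rightarrow> nat set set \<Rightarrow> nat set set" where
  "rest_of_ladder n X = rest (the_inv_into (colour_class n) ladder X)"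

lemma rest_of_ladder:
  assumes "A \<in> colour_class n"
  shows "rest_of_ladder n (ladder A) = rest A"
  unfolding rest_of_ladder_def by (simp add: the_inv_into_f_f[OF inj_on_ladder assms])

lemma finite_Int_parts:
  assumes "A \<in> \<A>" "B \<in> \<A>" "A \<noteq> B" "X = ladder A \<or> X = rest A" "Y = ladder B \<or> Y = rest B"
  shows "finite (X \<inter> Y)"
proof -
  have "X \<inter> Y \<subseteq> (ladder A - f ` A) \<union> (ladder B - f ` B) \<union> (f ` A \<inter> f ` B)"
    using assms by (auto simp: rest_def)
  then show ?thesis
    by (rule finite_subset) (simp add: finite_ladder_minus_code finite_code_Int[OF assms(1-3)])
qed

lemma ladder_rest_disjoint:
  assumes "A \<in> \<A>"
  shows "ladder A \<inter> rest A = {}"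
  using rest_not_below_height[OF assms] ladder_below_height[OF assms] by auto

lemma ad_sum_admissible_colour_class:
  "ad_sum_admissible (ladder ` colour_class n) (ladder ` long_class n) (rest_of_ladder n)
     (rest ` long_class n)"
  unfolding ad_sum_admissible_def almost_disjoint_def
proof (intro conjI)
  show "\<forall>X\<in>ladder ` colour_class n \<union> rest ` long_class n. infinite X"
    using infinite_ladder colour_classD long_classD by blast
  show "ladder ` long_class n \<subseteq> ladder ` colour_class n"
    using long_classD by blast
  show "rest_of_ladder n ` ladder ` long_class n \<subseteq> rest ` long_class n"
    using long_classD rest_of_ladder by auto
  show "inj_on (rest_of_ladder n) (ladder ` long_class n)"
  proof (rule inj_onI)
    fix X Y assume "X \<in> ladder ` long_class n" "Y \<in> ladder ` long_class n"
      "rest_of_ladder n X = rest_of_ladder n Y"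
    then obtain A B where AB: "A \<in> long_class n" "B \<in> long_class n" "X = ladder A" "Y = ladder B"
      "rest A = rest B"
      using long_classD rest_of_ladder by auto
    then have "rest A \<inter> rest B \<noteq> {}"
      using long_classD(3)[of A] by force
    then have "A = B"
      using e[of A B] AB long_classD colour_classD by metis
    then show "X = Y" using AB by simp
  qed
  show "pairwise (\<lambda>X Y. finite (X \<inter> Y)) (ladder ` colour_class n \<union> rest ` long_class n)"
    unfolding pairwise_def
  proof (intro ballI impI)
    fix X Y assume X: "X \<in> ladder ` colour_class n \<union> rest ` long_class n"
      and Y: "Y \<in> ladder ` colour_class n \<union> rest ` long_class n" and "X \<noteq> Y"
    obtain A where A: "A \<in> \<A>" "X = ladder A \<or> X = rest A"
      using X colour_classD long_classD by blast
    obtain B where B: "B \<in> \<A>" "Y = ladder B \<or> Y = rest B"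
      using Y colour_classD long_classD by blast
    show "finite (X \<inter> Y)"
    proof (cases "A = B")
      case True
      then have "X \<inter> Y = {}"
        using A B \<open>X \<noteq> Y\<close> ladder_rest_disjoint by auto
      then show ?thesis by simp
    next
      case False
      then show ?thesis using finite_Int_parts A B by blast
    qed
  qed
qed

definition recombined :: "'a set \<Rightarrow> nat set set" where
  "recombined A = ladder A \<union> (if finite (rest A) then {} else rest A)"

text \<open>
  Every infinite rest is paired with a ladder of the same class, so the sum has no summand that
  consists of a rest alone.
\<close>

lemma ad_sum_colour_class:
  "ad_sum (ladder ` colour_class n) (ladder ` long_class n) (rest_of_ladder n) (rest ` long_class n)
   = recombined ` colour_class n"
proof -
  have "ladder ` colour_class n - ladder ` long_class n = ladder ` (colour_class n - long_class n)"
    using long_classD(1) by (intro inj_on_image_set_diff[OF inj_on_ladder, symmetric]) auto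
  also have "\<dots> = recombined ` (colour_class n - long_class n)"
    by (auto simp: recombined_def long_class_def intro!: image_cong)
  finally have "ladder ` colour_class n - ladder ` long_class n =
      recombined ` (colour_class n - long_class n)" .
  moreover have "{X \<union> rest_of_ladder n X |X. X \<in> ladder ` long_class n} =
      (\<lambda>A. ladder A \<union> rest_of_ladder n (ladder A)) ` long_class n"
    by blast
  moreover have "\<dots> = recombined ` long_class n"
    using long_classD(1) by (intro image_cong) (auto simp: recombined_def rest_of_ladder long_class_def)
  moreover have "rest ` long_class n - rest_of_ladder n ` ladder ` long_class n = {}"
    using long_classD(1) rest_of_ladder by force
  moreover have "colour_class n = (colour_class n - long_class n) \<union> long_class n"
    using long_classD(1) by blast
  ultimately show ?thesis
    unfolding ad_sum_def by (metis image_Un sup_bot_right)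
qed

lemma equivalent_recombined: "equivalent_families \<A> (recombined ` \<A>)"
proof (rule equivalent_families_mod_finite[OF family])
  have sub: "recombined A \<subseteq> f ` \<Union>\<A>" if "A \<in> \<A>" for A
    using ladder_subset[OF that] that by (auto simp: recombined_def rest_def)
  have sup: "y \<in> \<Union>(recombined ` \<A>)" if "y \<in> f ` \<Union>\<A>" for y
  proof -
    \<comment> \<open>the only purpose of the padding: no code is lost with the finite rests\<close>
    have "pad y \<in> \<A>"
      using pad f_range that by blast
    moreover have "y \<in> recombined (pad y)"
      using that by (auto simp: recombined_def ladder_def)
    ultimately show ?thesis by blast
  qed
  have "f ` \<Union>\<A> = \<Union>(recombined ` \<A>)"
  proof (rule subset_antisym)
    show "f ` \<Union>\<A> \<subseteq> \<Union>(recombined ` \<A>)"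
      using sup by (rule subsetI)
    show "\<Union>(recombined ` \<A>) \<subseteq> f ` \<Union>\<A>"
      using sub by (rule UN_least)
  qed
  then show "bij_betw f (\<Union>\<A>) (\<Union>(recombined ` \<A>))"
    using inj_f by (simp add: bij_betw_def)
  fix A assume "A \<in> \<A>"
  have "sym_diff (recombined A) (f ` A) \<subseteq>
      (ladder A - f ` A) \<union> (if finite (rest A) then rest A else {})"
    by (auto simp: recombined_def rest_def ladder_def)
  then show "finite (sym_diff (recombined A) (f ` A))"
    by (rule finite_subset) (simp add: finite_ladder_minus_code)
qed

end

theorem theorem1p5:
  fixes \<A> :: "'a set set"
  assumes "countable_ad_family \<A>"
    and "locally_small \<A>"
    and "|\<A>| =o omega1"
  shows "\<exists>(\<L> :: nat \<Rightarrow> nat set set set) (\<L>' :: nat \<Rightarrow> nat set set set)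
            (\<phi> :: nat \<Rightarrow> nat set set \<Rightarrow> nat set set) (\<B> :: nat \<Rightarrow> nat set set set).
           (\<forall>n. ladder_family omega1 (\<L> n)) \<and>
           (\<forall>n. disjointifiable (\<B> n)) \<and>
           (\<forall>n. ad_sum_admissible (\<L> n) (\<L>' n) (\<phi> n) (\<B> n)) \<and>
           equivalent_families \<A> (\<Union>n. ad_sum (\<L> n) (\<L>' n) (\<phi> n) (\<B> n))"
proof -
  have "|\<Union>A\<in>\<A>. A| \<le>o omega1"
  proof (rule card_of_UNION_ordLeq_infinite_Field)
    show "infinite (Field omega1)"
      using uncountable_Field_omega1 countable_finite by blast
    show "|\<A>| \<le>o omega1"
      using assms(3) ordIso_imp_ordLeq by blast
    show "\<forall>A\<in>\<A>. |A| \<le>o omega1"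
      using assms(1) countable_card_le_natLeq cardSuc_ordLeq[OF natLeq_Card_order]
        ordLeq_transitive
      unfolding countable_ad_family_def by blast
  qed (rule cardSuc_Card_order[OF natLeq_Card_order])
  then obtain f where "inj_on f (\<Union>\<A>)" "f ` \<Union>\<A> \<subseteq> Field omega1 - E_omega omega1"
    using injection_into_successors[of "\<Union>\<A>"] by auto
  then interpret successor_coding \<A> f
    using assms(1,2) by unfold_locales
  obtain pad where pad: "inj_on pad (Field omega1)"
    "\<And>y. y \<in> Field omega1 \<Longrightarrow> pad y \<in> {A \<in> \<A>. y \<in> underS omega1 (height A)}"
    using padding_exists[OF uncountable_if_ordIso_omega1[OF assms(3)]] by metis
  obtain e :: "'a set \<Rightarrow> nat" where e:
    "\<And>A B. A \<in> \<A> \<Longrightarrow> B \<in> \<A> \<Longrightarrow> e A = e B \<Longrightarrow> A \<noteq> B \<Longrightarrow> height A \<noteq> height B \<and> rest A \<inter> rest B = {}"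
    using colouring_exists by metis
  interpret padded_coding \<A> f pad e
    using pad e by unfold_locales
  have "\<A> = (\<Union>n. colour_class n)"
    by (auto simp: colour_class_def)
  then have "(\<Union>n. ad_sum (ladder ` colour_class n) (ladder ` long_class n) (rest_of_ladder n)
      (rest ` long_class n)) = recombined ` \<A>"
    unfolding ad_sum_colour_class by (metis image_UN)
  then have "equivalent_families \<A> (\<Union>n. ad_sum (ladder ` colour_class n) (ladder ` long_class n)
      (rest_of_ladder n) (rest ` long_class n))"
    using equivalent_recombined by simp
  with ladder_family_colour_class disjointifiable_rests ad_sum_admissible_colour_class
  show ?thesis
    by (intro exI[of _ "\<lambda>n. ladder ` colour_class n"] exI[of _ "\<lambda>n. ladder ` long_class n"]
        exI[of _ rest_of_ladder] exI[of _ "\<lambda>n. rest ` long_class n"] conjI allI)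
qed

end
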